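(* Let $f$ be an increasing map from a dcpo $P$ to itself. The subposet $\mathrm{fix}(f)=\{x\in P: f(x)=x\}$ of $P$ is a dcpo. For every $x\in P$ such that $x\le f(x)$ there exists the least fixed point of $f$ above $x$ (that is, the set $\{y\in\mathrm{fix}(f): y\ge x\}$ has a least element). If $P$ has a least element, then $f$ has a least fixed point.
   Context: A subset of a poset is directed if it is nonempty and any two of its elements have an upper bound in it. A dcpo is a poset in which every directed subset has a join (no least element is required). Increasing means $x\le y$ implies $f(x)\le f(y)$. The subposet $\mathrm{fix}(f)$ carries the induced order; its directed joins need not coincide with those of $P$. *)

theory Defs
  imports "HOL-Algebra.Complete_Lattice"
begin

definition directed :: "('a, 'b) gorder_scheme \<Rightarrow> 'a set \<Rightarrow> bool" where
  "directed L D \<longleftrightarrow>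
     D \<subseteq> carrier L \<and> D \<noteq> {} \<and> (\<forall>x\<in>D. \<forall>y\<in>D. \<exists>z\<in>D. x \<sqsubseteq>\<^bsub>L\<^esub> z \<and> y \<sqsubseteq>\<^bsub>L\<^esub> z)"

text \<open>
  No least element is required. Joins are taken in \<open>L\<close> itself, so for a subposet
  \<open>L\<lparr>carrier := A\<rparr>\<close> only upper bounds lying in \<open>A\<close> are considered.
\<close>
locale dcpo = partial_order +
  assumes directed_sup_exists: "directed L D \<Longrightarrow> \<exists>s. is_lub L s D"

end

theory Submission
  imports Defs
begin

text \<open>
  For a post-fixed point \<open>x\<close>, let \<open>S\<close> be the set of post-fixed points above \<open>x\<close> that lie below
  every fixed point above \<open>x\<close>. It contains \<open>x\<close> and is closed under \<open>f\<close> and under directed joins,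
  so by Zorn's lemma it has a maximal element, which must be a fixed point. A directed set of fixed
  points has a post-fixed join \<open>s\<close> in \<open>P\<close>, and its join in \<open>fix(f)\<close> is the least fixed point above \<open>s\<close>.
\<close>

context dcpo
begin

lemma mem_fps_iff: "x \<in> fps L f \<longleftrightarrow> x \<in> carrier L \<and> f x = x"
  by (simp add: fps_def eq_is_equal)

text \<open>For \<open>y\<close> in \<open>D\<close>, monotonicity gives \<open>y\<close>
  \<sqsubseteq> \<open>f y\<close> \<sqsubseteq> \<open>f s\<close>. So \<open>f s\<close> is an
  upper bound of \<open>D\<close>, and the join lies below it.\<close>

lemma lub_of_postfixed_is_postfixed:
  assumes f: "f \<in> carrier L \<rightarrow> carrier L" "isotone L L f"
    and D: "D \<subseteq> carrier L" "\<And>y. y \<in> D \<Longrightarrow> y \<sqsubseteq> f y"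
    and s: "is_lub L s D"
  shows "s \<sqsubseteq> f s"
proof -
  have sc: "s \<in> carrier L" using s by simp
  have "y \<sqsubseteq> f s" if y: "y \<in> D" for y
  proof -
    have yc: "y \<in> carrier L" and ys: "y \<sqsubseteq> s"
      using y D(1) least_Upper_above[OF s] by auto
    have "f y \<sqsubseteq> f s" using use_iso1[OF f(2) yc sc ys] .
    with D(2)[OF y] show ?thesis
      by (rule le_trans) (use f(1) yc sc in auto)
  qed
  then have "f s \<in> Upper L D" using f(1) sc by (auto intro: Upper_memI)
  with s show ?thesis by (rule least_le)
qed

text \<open>Zorn's lemma applies because a nonempty chain is directed, the larger of two elements
  bounding both; its join exists and stays in \<open>S\<close> by \<open>lub\<close>.\<close>

lemma directed_closed_has_maximal:
  assumes S: "S \<subseteq> carrier L" "S \<noteq> {}"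
    and lub: "\<And>D s. directed L D \<Longrightarrow> D \<subseteq> S \<Longrightarrow> is_lub L s D \<Longrightarrow> s \<in> S"
  shows "\<exists>m\<in>S. \<forall>y\<in>S. m \<sqsubseteq> y \<longrightarrow> y = m"
proof (rule predicate_Zorn)
  show "partial_order_on S (relation_of (\<sqsubseteq>) S)"
  proof (rule partial_order_on_relation_ofI)
    fix a b c assume "a \<in> S" "b \<in> S" "c \<in> S" "a \<sqsubseteq> b" "b \<sqsubseteq> c"
    then show "a \<sqsubseteq> c" using S(1) le_trans[of a b c] by blast
  next
    fix a b assume "a \<in> S" "b \<in> S" "a \<sqsubseteq> b" "b \<sqsubseteq> a"
    then show "a = b" using S(1) le_antisym[of a b] by blast
  qed (use S(1) in auto)
next
  fix C assume "C \<in> Chains (relation_of (\<sqsubseteq>) S)"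
  then have CS: "C \<subseteq> S" and chain: "\<And>x y. x \<in> C \<Longrightarrow> y \<in> C \<Longrightarrow> x \<sqsubseteq> y \<or> y \<sqsubseteq> x"
    by (auto simp: Chains_def relation_of_def)
  show "\<exists>u\<in>S. \<forall>a\<in>C. a \<sqsubseteq> u"
  \<comment> \<open>The empty chain is not directed, so \<open>lub\<close> says nothing about it;
    any element of \<open>S\<close> bounds it.\<close>
  proof (cases "C = {}")
    case True
    then show ?thesis using S(2) by blast
  next
    case False
    have CL: "C \<subseteq> carrier L" using CS S(1) by blast
    have "\<exists>z\<in>C. x \<sqsubseteq> z \<and> y \<sqsubseteq> z" if "x \<in> C" "y \<in> C" for x y
      using chain[OF that] that CL le_refl by (meson subsetD)
    with False CL have dir: "directed L C" by (auto simp: directed_def)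
    then obtain s where s: "is_lub L s C" using directed_sup_exists by blast
    show ?thesis using lub[OF dir CS s] least_Upper_above[OF s _ CL] by blast
  qed
qed

lemma least_fixed_point_above:
  assumes f: "f \<in> carrier L \<rightarrow> carrier L" "isotone L L f"
    and x: "x \<in> carrier L" "x \<sqsubseteq> f x"
  shows "\<exists>m. least L m {y \<in> fps L f. x \<sqsubseteq> y}"
proof -
  define F where "F = {y \<in> fps L f. x \<sqsubseteq> y}"
  have F: "F \<subseteq> carrier L" "\<And>z. z \<in> F \<Longrightarrow> f z = z \<and> x \<sqsubseteq> z"
    by (auto simp: F_def mem_fps_iff)
  \<comment> \<open>The last clause makes any fixed point in \<open>S\<close> the least element of
    \<open>F\<close>, while \<open>y\<close> \<sqsubseteq> \<open>f y\<close> lets maximality be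
    tested against \<open>f y\<close>. At this stage \<open>F\<close> might be empty, and then the
    last clause holds vacuously.\<close>
  define S where "S = {y \<in> carrier L. x \<sqsubseteq> y \<and> y \<sqsubseteq> f y \<and> (\<forall>z\<in>F. y \<sqsubseteq> z)}"
  have "\<exists>m\<in>S. \<forall>y\<in>S. m \<sqsubseteq> y \<longrightarrow> y = m"
  proof (rule directed_closed_has_maximal)
    show "S \<subseteq> carrier L" "S \<noteq> {}" using x F by (auto simp: S_def)
    fix D s assume dir: "directed L D" and DS: "D \<subseteq> S" and s: "is_lub L s D"
    \<comment> \<open>A witness from the nonempty \<open>D\<close> carries the bound
      \<open>x\<close> \<sqsubseteq> \<open>d\<close> up to the join.\<close>
    obtain d where d: "d \<in> D" using dir by (auto simp: directed_def)
    have DL: "D \<subseteq> carrier L" using DS by (auto simp: S_def)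
    have sc: "s \<in> carrier L" using s by simp
    have "x \<sqsubseteq> d" "d \<sqsubseteq> s" using d DS least_Upper_above[OF s d DL] by (auto simp: S_def)
    then have "x \<sqsubseteq> s" by (rule le_trans) (use x(1) sc d DL in auto)
    moreover have "s \<sqsubseteq> f s"
      by (rule lub_of_postfixed_is_postfixed[OF f DL _ s]) (use DS in \<open>auto simp: S_def\<close>)
    moreover have "s \<sqsubseteq> z" if "z \<in> F" for z
      using that DS F(1) by (intro least_le[OF s] Upper_memI) (auto simp: S_def)
    ultimately show "s \<in> S" using sc by (auto simp: S_def)
  qed
  then obtain m where mS: "m \<in> S" and max: "\<And>y. y \<in> S \<Longrightarrow> m \<sqsubseteq> y \<Longrightarrow> y = m"
    by blast
  then have m: "m \<in> carrier L" "x \<sqsubseteq> m" "m \<sqsubseteq> f m" "\<And>z. z \<in> F \<Longrightarrow> m \<sqsubseteq> z"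
    by (auto simp: S_def)
  have fm: "f m \<in> carrier L" using f(1) m(1) by (rule Pi_mem)
  \<comment> \<open>The next facts place \<open>f m\<close> in \<open>S\<close>; since
    \<open>m\<close> \<sqsubseteq> \<open>f m\<close>, maximality then forces
    \<open>f m = m\<close>. Here \<open>f m\<close> \<sqsubseteq> \<open>f z = z\<close>.\<close>
  have "f m \<sqsubseteq> z" if z: "z \<in> F" for z
  proof -
    have "z \<in> carrier L" using F(1) z by blast
    then have "f m \<sqsubseteq> f z" using use_iso1[OF f(2) m(1) _ m(4)[OF z]] by blast
    then show ?thesis using F(2)[OF z] by simp
  qed
  moreover have "x \<sqsubseteq> f m" using le_trans[OF m(2,3) x(1) m(1) fm] .
  moreover have "f m \<sqsubseteq> f (f m)" using use_iso1[OF f(2) m(1) fm m(3)] .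
  ultimately have "f m \<in> S" using fm by (simp add: S_def)
  then have "f m = m" using max m(3) by blast
  then have "m \<in> F" using m by (simp add: F_def mem_fps_iff)
  then have "least L m F" using m(4) F(1) by (simp add: least_def)
  then show ?thesis unfolding F_def ..
qed

lemma dcpo_fpl:
  assumes f: "f \<in> carrier L \<rightarrow> carrier L" "isotone L L f"
  shows "dcpo (fpl L f)"
proof -
  have fpsL: "fps L f \<subseteq> carrier L" by (rule fps_carrier)
  \<comment> \<open>The order axioms pass to the subset, so only the equality axiom and directed
    joins remain to be checked below.\<close>
  interpret fp: weak_partial_order "fpl L f"
    by (rule weak_partial_order_subset[OF weak_partial_order_axioms fpsL])
  show ?thesis
  proof unfold_locales
    show "(.=\<^bsub>fpl L f\<^esub>) = (=)" by (simp add: eq_is_equal)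
  next
    fix D assume D: "directed (fpl L f) D"
    then have Df: "D \<subseteq> fps L f" by (simp add: directed_def)
    then have DL: "D \<subseteq> carrier L" using fpsL by blast
    have "directed L D" using D DL by (simp add: directed_def)
    then obtain s where s: "is_lub L s D" using directed_sup_exists by blast
    then have sc: "s \<in> carrier L" by simp
    have "y \<sqsubseteq> f y" if "y \<in> D" for y using that Df by (auto simp: mem_fps_iff)
    then have "s \<sqsubseteq> f s" using lub_of_postfixed_is_postfixed[OF f DL _ s] by blast
    then obtain m where m: "least L m {y \<in> fps L f. s \<sqsubseteq> y}"
      using least_fixed_point_above[OF f sc] by blast
    then have mf: "m \<in> fps L f" and sm: "s \<sqsubseteq> m" by (auto simp: least_def)
    \<comment> \<open>A fixed point bounds \<open>D\<close> exactly when it lies above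
      \<open>s\<close>, so the least fixed point above \<open>s\<close> is the least upper bound of
      \<open>D\<close> among fixed points.\<close>
    have "is_lub (fpl L f) m D"
    proof (rule least_UpperI)
      fix y assume y: "y \<in> D"
      have "y \<sqsubseteq> m"
        by (rule le_trans[OF least_Upper_above[OF s y DL] sm]) (use y DL sc mf in \<open>auto simp: mem_fps_iff\<close>)
      then show "y \<sqsubseteq>\<^bsub>fpl L f\<^esub> m" by simp
    next
      fix y assume "y \<in> Upper (fpl L f) D"
      then have y: "y \<in> fps L f" "\<And>d. d \<in> D \<Longrightarrow> d \<sqsubseteq> y"
        using Df by (auto simp: Upper_def)
      then have "s \<sqsubseteq> y" by (intro least_le[OF s] Upper_memI) (auto simp: mem_fps_iff)
      then show "m \<sqsubseteq>\<^bsub>fpl L f\<^esub> y" using least_le[OF m] y(1) by simp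
    qed (use Df mf in auto)
    then show "\<exists>s. is_lub (fpl L f) s D" ..
  qed
qed

end

theorem theorem3p4:
  fixes P :: "('a, 'b) gorder_scheme" and f :: "'a \<Rightarrow> 'a"
  assumes "dcpo P"
    and "f \<in> carrier P \<rightarrow> carrier P"
    and "isotone P P f"
  shows "dcpo (fpl P f) \<and>
    (\<forall>x\<in>carrier P. x \<sqsubseteq>\<^bsub>P\<^esub> f x \<longrightarrow> (\<exists>m. least P m {y \<in> fps P f. x \<sqsubseteq>\<^bsub>P\<^esub> y})) \<and>
    ((\<exists>b. least P b (carrier P)) \<longrightarrow> (\<exists>m. least P m (fps P f)))"
proof (intro conjI ballI impI)
  interpret dcpo P by fact
  show "dcpo (fpl P f)" using assms(2,3) by (rule dcpo_fpl)
  show above: "\<exists>m. least P m {y \<in> fps P f. x \<sqsubseteq>\<^bsub>P\<^esub> y}"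
    if "x \<in> carrier P" "x \<sqsubseteq>\<^bsub>P\<^esub> f x" for x
    using least_fixed_point_above[OF assms(2,3) that] .
  assume "\<exists>b. least P b (carrier P)"
  then obtain b where b: "b \<in> carrier P" "\<And>y. y \<in> carrier P \<Longrightarrow> b \<sqsubseteq>\<^bsub>P\<^esub> y"
    by (auto simp: least_def)
  \<comment> \<open>The bottom element \<open>b\<close> is post-fixed and lies below every fixed
    point, so the least fixed point above \<open>b\<close> is least among all of them.\<close>
  then have "b \<sqsubseteq>\<^bsub>P\<^esub> f b" using assms(2) by blast
  moreover have "{y \<in> fps P f. b \<sqsubseteq>\<^bsub>P\<^esub> y} = fps P f" using b by (auto simp: mem_fps_iff)
  ultimately show "\<exists>m. least P m (fps P f)" using above b(1) by force
qed

end
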